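(* Let $n\geq 2$ and let $a_1,\ldots,a_n$ be real numbers. Then $$\kappa(n)+\tau_{n,1}\geq (2a_n-a_{n-1}-a_1)+\sum_{j=1}^{n-2}d_j^{n-j}.$$
   Context: Set $d_i^0=a_i$ for $1\leq i\leq n$, and for $k\geq 1$ define $d_j^k=|d_{j+1}^{k-1}-d_j^{k-1}|$ for $1\leq j\leq n-k$. The length of the circuit is $\kappa(n)=\sum_{k=1}^{n-1}\sum_{j=1}^{n-k}d_j^k$, and the trace of the $s$-th segment is $\tau_{n,s}=\sum_{k=1}^{n-s}d_s^k$. *)

theory Defs
  imports Complex_Main
begin

text \<open>
  A tuple of reals indexed from 1 to n is encoded as a function on the naturals; only its values
  at the indices 1 to n matter. Below, diff_abs a k j has the level k (the superscript) before the
  position j (the subscript), and it depends only on the values of a from j to j + k. So for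
  k \<ge> 1 and 1 \<le> j \<le> n - k it involves only the given entries.
\<close>

fun diff_abs :: "(nat \<Rightarrow> real) \<Rightarrow> nat \<Rightarrow> nat \<Rightarrow> real" where
  "diff_abs a 0 j = a j"
| "diff_abs a (Suc k) j = \<bar>diff_abs a k (j + 1) - diff_abs a k j\<bar>"

definition circuit_length :: "(nat \<Rightarrow> real) \<Rightarrow> nat \<Rightarrow> real" where
  "circuit_length a n = (\<Sum>k = 1..n - 1. \<Sum>j = 1..n - k. diff_abs a k j)"

definition segment_trace :: "(nat \<Rightarrow> real) \<Rightarrow> nat \<Rightarrow> nat \<Rightarrow> real" where
  "segment_trace a n s = (\<Sum>k = 1..n - s. diff_abs a k s)"

end

theory Submission
  imports Defs
begin

text \<open>
  Write \<open>D\<close> for the sum of the antidiagonal \<open>d\<^sub>m\<^sub>-\<^sub>k\<^sup>k\<close>, \<open>1 \<le> k \<le> m - 1\<close>, so that passing from \<open>m - 1\<close> to \<open>m\<close>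
  increases the circuit length by \<open>D\<close>.  Descending between two adjacent antidiagonals by
  \<open>x \<le> y + \<bar>x - y\<bar>\<close> gives \<open>a\<^sub>m\<^sub>+\<^sub>1 - a\<^sub>m \<le> D + d\<^sub>1\<^sup>m\<close>; summed over \<open>m < n\<close> this is
  \<open>a\<^sub>n - a\<^sub>1 \<le> \<kappa>(n - 1) + \<tau>\<close>, with \<open>\<tau>\<close> the trace of the first segment.  The last antidiagonal of the
  circuit of \<open>n\<close> points consists of the sum in the claim and \<open>\<bar>a\<^sub>n - a\<^sub>n\<^sub>-\<^sub>1\<bar>\<close>.
\<close>

text \<open>Level plus position is \<open>m\<close> in the sum and \<open>m + 1\<close> in the last
  term; each induction step trades that term for a new summand and a new last term.\<close>

lemma step_le_partial_antidiagonal: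
  assumes "r < m"
  shows "a (Suc m) - a m \<le> (\<Sum>k = 1..r. diff_abs a k (m - k)) + diff_abs a (Suc r) (m - r)"
  using assms
proof (induction r)
  case 0
  then show ?case by simp
next
  case (Suc r)
  have "Suc (m - Suc r) = m - r"
    using Suc.prems by simp
  then have "diff_abs a (Suc (Suc r)) (m - Suc r)
      = \<bar>diff_abs a (Suc r) (m - r) - diff_abs a (Suc r) (m - Suc r)\<bar>"
    by (metis diff_abs.simps(2) Suc_eq_plus1)
  then show ?case
    using Suc.IH Suc.prems by (simp del: diff_abs.simps)
qed

lemma circuit_length_Suc:
  "circuit_length a (Suc m) = circuit_length a m + (\<Sum>k = 1..m. diff_abs a k (Suc m - k))"
proof -
  have "circuit_length a (Suc m)
      = (\<Sum>k = 1..m. (\<Sum>j = 1..m - k. diff_abs a k j) + diff_abs a k (Suc m - k))"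
    unfolding circuit_length_def by (auto intro!: sum.cong simp: Suc_diff_le)
  also have "\<dots> = (\<Sum>k = 1..m. \<Sum>j = 1..m - k. diff_abs a k j)
      + (\<Sum>k = 1..m. diff_abs a k (Suc m - k))"
    by (rule sum.distrib)
  \<comment> \<open>The extra level \<open>k = m\<close> has an empty inner sum.\<close>
  also have "(\<Sum>k = 1..m. \<Sum>j = 1..m - k. diff_abs a k j) = circuit_length a m"
    unfolding circuit_length_def by (cases m) simp_all
  finally show ?thesis .
qed

lemma step_le_antidiagonal:
  "a (Suc (Suc m)) - a (Suc m)
    \<le> (\<Sum>k = 1..m. diff_abs a k (Suc m - k)) + diff_abs a (Suc m) 1"
  using step_le_partial_antidiagonal[of m "Suc m" a] by (simp del: diff_abs.simps)

lemma segment_trace_Suc: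
  "segment_trace a (Suc (Suc m)) 1 = segment_trace a (Suc m) 1 + diff_abs a (Suc m) 1"
  by (simp add: segment_trace_def del: diff_abs.simps)

lemma increment_le_circuit_length_plus_trace:
  "a (Suc m) - a 1 \<le> circuit_length a m + segment_trace a (Suc m) 1"
proof (induction m)
  case 0
  then show ?case by (simp add: circuit_length_def segment_trace_def)
next
  case (Suc m)
  then show ?case
    using step_le_antidiagonal[of a m] circuit_length_Suc[of a m] segment_trace_Suc[of a m]
    by linarith
qed

lemma antidiagonal_eq:
  "(\<Sum>k = 1..Suc m. diff_abs a k (Suc (Suc m) - k))
    = (\<Sum>j = 1..m. diff_abs a (Suc (Suc m) - j) j) + \<bar>a (Suc (Suc m)) - a (Suc m)\<bar>"
proof -
  have "(\<Sum>k = 1..Suc m. diff_abs a k (Suc (Suc m) - k))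
      = (\<Sum>j = 1..Suc m. diff_abs a (Suc (Suc m) - j) j)"
    \<comment> \<open>Reversal sets \<open>j = Suc (Suc m) - k\<close>; the term
      \<open>j = Suc m\<close> then has level 1.\<close>
    by (subst sum.atLeastAtMost_rev) (auto intro!: sum.cong simp del: diff_abs.simps)
  then show ?thesis by simp
qed

theorem theorem4p7:
  fixes a :: "nat \<Rightarrow> real" and n :: nat
  assumes "n \<ge> 2"
  shows "circuit_length a n + segment_trace a n 1
    \<ge> (2 * a n - a (n - 1) - a 1) + (\<Sum>j = 1..n - 2. diff_abs a (n - j) j)"
proof -
  obtain m where n: "n = Suc (Suc m)"
    using assms by (metis add_2_eq_Suc le_Suc_ex)
  have "a n - a 1 \<le> circuit_length a (Suc m) + segment_trace a n 1"
    using increment_le_circuit_length_plus_trace[of a "Suc m"] n by simp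
  moreover have "circuit_length a n = circuit_length a (Suc m)
      + (\<Sum>j = 1..n - 2. diff_abs a (n - j) j) + \<bar>a n - a (n - 1)\<bar>"
    using circuit_length_Suc[of a "Suc m"] antidiagonal_eq[of a m] n by simp
  \<comment> \<open>Here \<open>2 * a n - a (n - 1) - a 1\<close> splits into
    \<open>a n - a 1\<close> and \<open>a n - a (n - 1)\<close>.\<close>
  ultimately show ?thesis by linarith
qed

end
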